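(* Let $d\ge 1$. For every absolutely continuous curve $\alpha:[0,1]\to\mathbb{R}^d$ and every $\xi\in S^{d-1}$, $$M_\alpha(\xi)=\int_{P^{d-1}} f_\xi\, d\mu_\alpha ,$$ and the measure $\mu_\alpha$ is uniquely determined by the function $M_\alpha$: if $\alpha,\beta:[0,1]\to\mathbb{R}^d$ are absolutely continuous curves with $M_\alpha(\xi)=M_\beta(\xi)$ for all $\xi\in S^{d-1}$, then $\mu_\alpha=\mu_\beta$.
   Context: $P^{d-1}$ is real projective space of dimension $d-1$, and $\pi:S^{d-1}\to P^{d-1}$ is the projection identifying antipodal points of the unit sphere. For an absolutely continuous curve $\alpha:[0,1]\to\mathbb{R}^d$ and $\xi\in S^{d-1}$, $M_\alpha(\xi)=\int_0^1|\xi\cdot\alpha'(t)|\,dt$ (the length of the projection of $\alpha$ onto a line parallel to $\xi$). For $f\in C(P^{d-1})$, $\hat f:\mathbb{R}^d\to\mathbb{R}$ denotes the degree $1$ homogeneous extension $\hat f(r\xi)=|r|\,f(\pi(\xi))$ for $r\in\mathbb{R}$, $\xi\in S^{d-1}$ (so $\hat f(0)=0$). The measure $\mu_\alpha$ is the unique finite positive Borel measure on $P^{d-1}$ with $\int f\,d\mu_\alpha=\int_0^1\hat f(\alpha'(t))\,dt$ for all $f\in C(P^{d-1})$ (Riesz representation theorem). For $\xi\in S^{d-1}$, $f_\xi:P^{d-1}\to\mathbb{R}$ is $f_\xi(x)=|\xi\cdot u|$ for either $u\in\pi^{-1}(x)$. *)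

theory Defs
  imports "HOL-Analysis.Analysis"
begin

section \<open>Projective space as the sphere modulo antipodes\<close>

definition antipodal_rel :: "'a::euclidean_space \<Rightarrow> 'a \<Rightarrow> bool"
  where "antipodal_rel u v \<longleftrightarrow> norm u = 1 \<and> norm v = 1 \<and> (u = v \<or> u = - v)"

text \<open>The partial quotient is taken on the unit sphere only, so for
  \<open>'a = real^'n\<close> this is the projective space of dimension \<open>CARD('n) - 1\<close>.\<close>

quotient_type (overloaded) 'a projsp = "'a::euclidean_space" / partial: antipodal_rel
proof (rule part_equivpI)
  show "\<exists>u::'a. antipodal_rel u u"
    unfolding antipodal_rel_def using SOME_Basis norm_Basis by blast
  show "symp (antipodal_rel :: 'a \<Rightarrow> 'a \<Rightarrow> bool)"
    by (auto simp: symp_def antipodal_rel_def)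
  show "transp (antipodal_rel :: 'a \<Rightarrow> 'a \<Rightarrow> bool)"
    by (auto simp: transp_def antipodal_rel_def)
qed

text \<open>The projection \<open>\<pi>\<close>; it is meaningful on unit vectors only.\<close>

definition proj :: "'a::euclidean_space \<Rightarrow> 'a projsp"
  where "proj u = abs_projsp u"

lemma proj_eq_iff:
  assumes "norm u = 1" "norm v = 1"
  shows "proj u = proj v \<longleftrightarrow> u = v \<or> u = - v"
proof -
  have "proj u = proj v \<longleftrightarrow> antipodal_rel u v"
    using Quotient3_rel[OF Quotient3_projsp, of u v] assms
    by (simp add: proj_def antipodal_rel_def)
  with assms show ?thesis by (simp add: antipodal_rel_def)
qed

lemma proj_surj: "proj ` sphere 0 1 = UNIV"
proof -
  have "x \<in> proj ` sphere 0 1" for x :: "'a projsp"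
  proof -
    have "antipodal_rel (rep_projsp x) (rep_projsp x)"
      by (rule Quotient3_rep_reflp[OF Quotient3_projsp])
    moreover have "proj (rep_projsp x) = x"
      by (simp add: proj_def Quotient3_abs_rep[OF Quotient3_projsp])
    ultimately show ?thesis
      by (metis antipodal_rel_def imageI mem_sphere_0)
  qed
  then show ?thesis by blast
qed

text \<open>The topology is the quotient topology of the unit sphere.\<close>

instantiation projsp :: (euclidean_space) topological_space
begin

definition open_projsp :: "'a projsp set \<Rightarrow> bool"
  where "open_projsp U \<longleftrightarrow> openin (top_of_set (sphere 0 1)) {u \<in> sphere 0 1. proj u \<in> U}"

instance
proof
  have "{u \<in> sphere (0::'a) 1. proj u \<in> UNIV} = topspace (top_of_set (sphere 0 1))"
    by auto
  then show "open (UNIV :: 'a projsp set)"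
    unfolding open_projsp_def by (simp only: openin_topspace)
next
  fix S T :: "'a projsp set"
  assume ST: "open S" "open T"
  have eq: "{u \<in> sphere 0 1. proj u \<in> S \<inter> T} =
      {u \<in> sphere 0 1. proj u \<in> S} \<inter> {u \<in> sphere 0 1. proj u \<in> T}" by blast
  show "open (S \<inter> T)"
    unfolding open_projsp_def eq by (rule openin_Int[OF ST[unfolded open_projsp_def]])
next
  fix K :: "'a projsp set set"
  assume K: "\<forall>S\<in>K. open S"
  have eq: "{u \<in> sphere 0 1. proj u \<in> \<Union>K} = \<Union>((\<lambda>S. {u \<in> sphere 0 1. proj u \<in> S}) ` K)"
    by blast
  show "open (\<Union>K)"
    unfolding open_projsp_def eq
  proof (rule openin_Union)
    fix A assume "A \<in> (\<lambda>S. {u \<in> sphere 0 1. proj u \<in> S}) ` K"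
    then obtain S where S: "S \<in> K" "A = {u \<in> sphere 0 1. proj u \<in> S}" by (rule imageE)
    from K S(1) have "open S" by (rule bspec)
    then show "openin (top_of_set (sphere 0 1)) A"
      unfolding open_projsp_def S(2) .
  qed
qed

end

lift_definition abs_inner_proj :: "'a::euclidean_space \<Rightarrow> 'a projsp \<Rightarrow> real"
  is "\<lambda>\<xi> u. \<bar>\<xi> \<bullet> u\<bar>"
  by (auto simp: antipodal_rel_def)

lemma abs_inner_proj_proj: "norm u = 1 \<Longrightarrow> abs_inner_proj \<xi> (proj u) = \<bar>\<xi> \<bullet> u\<bar>"
  unfolding proj_def by (rule abs_inner_proj.abs_eq) (simp add: antipodal_rel_def)

definition hom_ext :: "('a::euclidean_space projsp \<Rightarrow> real) \<Rightarrow> 'a \<Rightarrow> real"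
  where "hom_ext f v = norm v * f (proj (sgn v))"

lemma hom_ext_scaleR:
  assumes "norm \<xi> = 1"
  shows "hom_ext f (r *\<^sub>R \<xi>) = \<bar>r\<bar> * f (proj \<xi>)"
proof (cases "r = 0")
  case False
  have "proj (sgn (r *\<^sub>R \<xi>)) = proj \<xi>"
    using assms False by (subst proj_eq_iff) (auto simp: sgn_div_norm sgn_scaleR real_sgn_eq abs_if)
  with assms show ?thesis by (simp add: hom_ext_def)
qed (simp add: hom_ext_def)


section \<open>Absolutely continuous curves\<close>

definition abs_cont_curve :: "(real \<Rightarrow> 'a::euclidean_space) \<Rightarrow> bool"
  where "abs_cont_curve \<alpha> \<longleftrightarrow>
    (\<forall>\<epsilon>>0. \<exists>\<delta>>0. \<forall>(n::nat) a b.
       (\<forall>i<n. 0 \<le> a i \<and> a i \<le> b i \<and> b i \<le> 1) \<and>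
       disjoint_family_on (\<lambda>i. {a i<..<b i}) {..<n} \<and>
       (\<Sum>i<n. b i - a i) < \<delta> \<longrightarrow>
       (\<Sum>i<n. norm (\<alpha> (b i) - \<alpha> (a i))) < \<epsilon>)"

text \<open>An absolutely continuous curve is differentiable almost everywhere; on the exceptional
  null set the value of \<^const>\<open>vector_derivative\<close> is arbitrary.  The integrals below are
  therefore taken with respect to the complete measure \<^const>\<open>lebesgue\<close>.\<close>

definition curve_deriv :: "(real \<Rightarrow> 'a::euclidean_space) \<Rightarrow> real \<Rightarrow> 'a"
  where "curve_deriv \<alpha> t = vector_derivative \<alpha> (at t within {0..1})"

definition proj_length :: "(real \<Rightarrow> 'a::euclidean_space) \<Rightarrow> 'a \<Rightarrow> real"
  where "proj_length \<alpha> \<xi> = (LINT t:{0..1}|lebesgue. \<bar>\<xi> \<bullet> curve_deriv \<alpha> t\<bar>)"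

definition curve_measure :: "(real \<Rightarrow> 'a::euclidean_space) \<Rightarrow> 'a projsp measure"
  where "curve_measure \<alpha> =
    (THE \<mu>. sets \<mu> = sets borel \<and> finite_measure \<mu> \<and>
       (\<forall>f. continuous_on UNIV f \<longrightarrow>
          integral\<^sup>L \<mu> f = (LINT t:{0..1}|lebesgue. hom_ext f (curve_deriv \<alpha> t))))"

end

theory Submission
  imports Defs "HOL-Probability.Probability"
begin

text \<open>
  The derivative \<open>g\<close> of an absolutely continuous curve is integrable over \<open>{0..1}\<close>
  (\<open>curve_deriv_integrable\<close>).  The image of the weighted measure \<open>norm (g t) dt\<close> under the direction map
  \<open>t \<mapsto> proj (sgn (g t))\<close> is then finite and integrates every continuous \<open>f\<close> to \<open>\<integral> hom_ext f (g t) dt\<close>.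
  Integrals of continuous functions determine a finite Borel measure on projective space, so this image
  is \<open>\<mu>\<^sub>\<alpha>\<close> (\<open>direction_measure_unique\<close>), and the formula for \<open>M\<^sub>\<alpha>\<close> is the case
  \<open>f = abs_inner_proj \<xi>\<close>.

  What remains is the injectivity of the cosine transform \<open>\<mu> \<mapsto> (\<xi> \<mapsto> \<integral>\<bar>\<xi> \<bullet> u\<bar> d\<mu>(u))\<close>.  By homogeneity the
  transform is known for all vectors \<open>\<xi>\<close>, so it can be averaged over a random \<open>\<xi>\<close>.  If \<open>\<xi>\<close> is a centred
  Gaussian vector with covariance \<open>1 + \<tau> w w\<^sup>T\<close>, then \<open>\<xi> \<bullet> u\<close> is normal with variance
  \<open>1 + \<tau> (w \<bullet> u)\<^sup>2\<close> for a unit vector \<open>u\<close>, and \<open>\<bar>\<xi> \<bullet> u\<bar>\<close> has mean \<open>sqrt (2 / pi) * sqrt (1 + \<tau> (w \<bullet> u)\<^sup>2)\<close>.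
  The transform therefore determines \<open>\<integral> sqrt (1 + \<tau> (w \<bullet> u)\<^sup>2) d\<mu>(u)\<close> for all \<open>w\<close> and all \<open>\<tau> \<ge> 0\<close>
  (\<open>rank_one_perturbation\<close>).  The coefficients of the binomial series of the square root do not vanish,
  so comparing powers of \<open>\<tau>\<close> gives the moments \<open>\<integral> (w \<bullet> u) ^ (2 * k) d\<mu>(u)\<close>, and the cosine
  series gives \<open>\<integral> cos (w \<bullet> u) d\<mu>(u)\<close>.  Since a product of two such cosines is an average of two others,
  their span is an algebra of functions on projective space; it separates points and is dense by the
  Stone--Weierstrass theorem (\<open>measure_eqI_sqrt_integrals\<close>).
\<close>

section \<open>Topology and finite Borel measures on projective space\<close>

lemma rep_projsp_sphere: "norm (rep_projsp x) = 1"
  using Quotient3_rep_reflp[OF Quotient3_projsp, of x] by (simp add: antipodal_rel_def)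

lemma proj_rep: "proj (rep_projsp x) = x"
  unfolding Defs.proj_def by (rule Quotient3_abs_rep[OF Quotient3_projsp])

lemma rep_proj:
  assumes "norm u = 1"
  shows "rep_projsp (proj u) = u \<or> rep_projsp (proj u) = - u"
  using proj_eq_iff[of "rep_projsp (proj u)" u] assms by (simp add: rep_projsp_sphere proj_rep)

lemma abs_inner_proj_rep: "abs_inner_proj \<xi> x = \<bar>\<xi> \<bullet> rep_projsp x\<bar>"
  using abs_inner_proj_proj[of "rep_projsp x" \<xi>] by (simp add: rep_projsp_sphere proj_rep)

lemma continuous_on_proj: "continuous_on (sphere 0 1) (proj :: 'a::euclidean_space \<Rightarrow> 'a projsp)"
proof -
  have eq: "proj -` U \<inter> sphere 0 1 = {u \<in> sphere 0 1. proj u \<in> U}" for U :: "'a projsp set"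
    by auto
  show ?thesis
    unfolding continuous_on_open_invariant eq
  proof (intro allI impI)
    fix U :: "'a projsp set"
    assume "open U"
    then obtain T where "open T" "{u \<in> sphere 0 1. proj u \<in> U} = sphere 0 1 \<inter> T"
      unfolding open_projsp_def openin_open by auto
    then show "\<exists>A. open A \<and> A \<inter> sphere 0 1 = {u \<in> sphere 0 1. proj u \<in> U}"
      by (intro exI[of _ T]) (simp add: Int_commute)
  qed
qed

lemma continuous_on_projsp_iff:
  fixes f :: "'a::euclidean_space projsp \<Rightarrow> 'b::topological_space"
  shows "continuous_on UNIV f \<longleftrightarrow> continuous_on (sphere 0 1) (\<lambda>u. f (proj u))"
proof
  assume "continuous_on UNIV f"
  then show "continuous_on (sphere 0 1) (\<lambda>u. f (proj u))"
    using continuous_on_compose2[OF _ continuous_on_proj] by blast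
next
  assume f: "continuous_on (sphere 0 1) (\<lambda>u. f (proj u))"
  have "open (f -` V)" if "open V" for V
  proof -
    have "{u \<in> sphere 0 1. proj u \<in> f -` V} = sphere 0 1 \<inter> (\<lambda>u. f (proj u)) -` V"
      by auto
    then show ?thesis
      using continuous_openin_preimage_gen[OF f that] by (simp add: open_projsp_def)
  qed
  then show "continuous_on UNIV f"
    by (simp add: continuous_on_open_vimage)
qed

text \<open>The choice function \<^const>\<open>rep_projsp\<close> need not be continuous, but an even function cannot see which of
the two antipodes was chosen.\<close>

lemma continuous_on_even_lift:
  assumes "continuous_on (sphere 0 1) \<phi>" and "\<And>u. norm u = 1 \<Longrightarrow> \<phi> (- u) = \<phi> u"
  shows "continuous_on UNIV (\<lambda>x. \<phi> (rep_projsp x))"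
proof -
  have "\<phi> (rep_projsp (proj u)) = \<phi> u" if "u \<in> sphere 0 1" for u
    using rep_proj[of u] assms(2)[of u] that by auto
  then have "continuous_on (sphere 0 1) (\<lambda>u. \<phi> (rep_projsp (proj u)))"
    by (subst continuous_on_cong[OF refl]) (use assms(1) in auto)
  then show ?thesis
    by (simp add: continuous_on_projsp_iff)
qed

lemma continuous_on_abs_inner_proj: "continuous_on UNIV (abs_inner_proj \<xi>)"
proof -
  have "abs_inner_proj \<xi> = (\<lambda>x. \<bar>\<xi> \<bullet> rep_projsp x\<bar>)"
    by (simp add: abs_inner_proj_rep fun_eq_iff)
  moreover have "continuous_on UNIV (\<lambda>x. \<bar>\<xi> \<bullet> rep_projsp x\<bar>)"
    by (rule continuous_on_even_lift) (auto intro!: continuous_intros)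
  ultimately show ?thesis by simp
qed

lemma abs_inner_proj_le: "abs_inner_proj \<xi> x \<le> norm \<xi>"
  using Cauchy_Schwarz_ineq2[of \<xi> "rep_projsp x"] by (simp add: abs_inner_proj_rep rep_projsp_sphere)

lemma abs_inner_proj_nonneg: "0 \<le> abs_inner_proj \<xi> x"
  by (simp add: abs_inner_proj_rep)

text \<open>Separation of points by \<^const>\<open>abs_inner_proj\<close> comes from the equality case of the Cauchy--Schwarz
inequality.  It gives both the Hausdorff property of projective space and the separation of
points needed for the Stone--Weierstrass theorem.\<close>

lemma abs_inner_proj_separates:
  assumes "x \<noteq> y"
  shows "abs_inner_proj (rep_projsp x) x = 1 \<and> abs_inner_proj (rep_projsp x) y < 1"
proof -
  let ?u = "rep_projsp x" and ?v = "rep_projsp y"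
  have n: "norm ?u = 1" "norm ?v = 1" by (simp_all add: rep_projsp_sphere)
  have "?u \<noteq> ?v" "?u \<noteq> - ?v"
    using assms proj_eq_iff[OF n] by (auto simp: proj_rep)
  then have "\<bar>?u \<bullet> ?v\<bar> \<noteq> 1"
    using norm_cauchy_schwarz_abs_eq[of ?u ?v] n by auto
  then have "\<bar>?u \<bullet> ?v\<bar> < 1"
    using Cauchy_Schwarz_ineq2[of ?u ?v] n by simp
  then show ?thesis
    using n by (simp add: abs_inner_proj_rep dot_square_norm)
qed

instance projsp :: (euclidean_space) t2_space
proof
  fix x y :: "'a projsp"
  assume "x \<noteq> y"
  then obtain w where "abs_inner_proj w y \<noteq> abs_inner_proj w x"
    using abs_inner_proj_separates by fastforce
  then obtain U V where UV: "open U" "open V" "abs_inner_proj w x \<in> U" "abs_inner_proj w y \<in> V" "U \<inter> V = {}"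
    by (metis hausdorff)
  have "open (abs_inner_proj w -` U)" "open (abs_inner_proj w -` V)"
    using continuous_on_abs_inner_proj[of w] UV by (auto simp: continuous_on_open_vimage)
  then show "\<exists>U V. open U \<and> open V \<and> x \<in> U \<and> y \<in> V \<and> U \<inter> V = {}"
    using UV by (intro exI[of _ "abs_inner_proj w -` U"] exI[of _ "abs_inner_proj w -` V"]) auto
qed

lemma compact_projsp: "compact (UNIV :: 'a::euclidean_space projsp set)"
  using compact_continuous_image[OF continuous_on_proj compact_sphere] by (simp add: proj_surj)

lemma bounded_continuous_projsp:
  fixes f :: "'a::euclidean_space projsp \<Rightarrow> real"
  assumes "continuous_on UNIV f"
  obtains B where "\<And>x. \<bar>f x\<bar> \<le> B"
proof -
  have "bounded (range f)"
    using compact_continuous_image[OF assms compact_projsp] compact_imp_bounded by blast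
  then show thesis
    using that by (auto simp: bounded_iff)
qed

lemma integrable_continuous_projsp:
  fixes f :: "'a::euclidean_space projsp \<Rightarrow> real"
  assumes "finite_measure \<mu>" "sets \<mu> = sets borel" "continuous_on UNIV f"
  shows "integrable \<mu> f"
proof -
  interpret finite_measure \<mu> by fact
  obtain B where "\<And>x. \<bar>f x\<bar> \<le> B" using bounded_continuous_projsp[OF assms(3)] by blast
  moreover have "f \<in> borel_measurable \<mu>"
    using borel_measurable_continuous_onI[OF assms(3)] assms(2) by (simp cong: measurable_cong_sets)
  ultimately show ?thesis
    by (intro integrable_const_bound[of _ B]) auto
qed

text \<open>The uniqueness half of the Riesz representation theorem.  Open sets generate the Borel sets, and
the indicator of an open set \<open>U\<close> is the bounded pointwise limit of the continuous functions
\<open>min 1 (n * dist)\<close>, with \<open>dist\<close> the distance on the sphere to the preimage of the complement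
of \<open>U\<close>; that distance is even because the preimage is symmetric.\<close>

lemma projsp_measure_eqI:
  fixes \<mu> \<nu> :: "'a::euclidean_space projsp measure"
  assumes \<mu>: "finite_measure \<mu>" "sets \<mu> = sets borel"
    and \<nu>: "finite_measure \<nu>" "sets \<nu> = sets borel"
    and eq: "\<And>f :: 'a projsp \<Rightarrow> real. continuous_on UNIV f \<Longrightarrow> integral\<^sup>L \<mu> f = integral\<^sup>L \<nu> f"
  shows "\<mu> = \<nu>"
proof -
  have openeq: "measure \<mu> U = measure \<nu> U" if U: "open U" for U
  proof -
    define K where "K = {u \<in> sphere 0 1. proj u \<notin> U}"
    have K: "closed K"
    proof -
      have "K = topspace (top_of_set (sphere 0 1)) - {u \<in> sphere 0 1. proj u \<in> U}"
        by (auto simp: K_def)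
      then have "closedin (top_of_set (sphere 0 1)) K"
        using closedin_diff[OF closedin_topspace U[unfolded open_projsp_def]] by simp
      then show ?thesis using closedin_closed_trans closed_sphere by blast
    qed
    have projm: "proj (- u) = proj u" if "norm u = 1" for u :: 'a
      using that by (subst proj_eq_iff) auto
    have Kminus: "uminus ` K = K"
    proof -
      have "uminus ` K \<subseteq> K" by (auto simp: K_def projm)
      then show ?thesis by force
    qed
    \<comment> \<open>\<^term>\<open>infdist u {}\<close> is 0 by convention, so \<open>U = UNIV\<close> has to be treated apart.\<close>
    define f :: "nat \<Rightarrow> 'a projsp \<Rightarrow> real"
      where "f n x = (if K = {} then 1 else min 1 (real n * infdist (rep_projsp x) K))" for n x
    have even: "infdist (- u) K = infdist u K" if "norm u = 1" for u
    proof -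
      have "infdist (- u) K = infdist (- u) (uminus ` K)" by (simp add: Kminus)
      also have "\<dots> = infdist u K"
        by (simp add: infdist_def image_image dist_norm norm_minus_commute add.commute[of _ u])
      finally show ?thesis .
    qed
    have cont: "continuous_on UNIV (f n)" for n
    proof (cases "K = {}")
      case False
      have "continuous_on (sphere 0 1) (\<lambda>u. min 1 (real n * infdist u K))"
        by (intro continuous_intros)
      then have "continuous_on UNIV (\<lambda>x. min 1 (real n * infdist (rep_projsp x) K))"
        by (rule continuous_on_even_lift) (simp add: even)
      then show ?thesis using False by (simp add: f_def)
    qed (simp add: f_def)
    have lim: "(\<lambda>n. f n x) \<longlonglongrightarrow> indicat_real U x" for x
    proof (cases "x \<in> U")
      case True
      then have nK: "rep_projsp x \<notin> K" by (simp add: K_def proj_rep)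
      have "eventually (\<lambda>n. f n x = 1) sequentially"
      proof (cases "K = {}")
        case False
        then have "infdist (rep_projsp x) K > 0"
          using nK K in_closed_iff_infdist_zero infdist_nonneg[of "rep_projsp x" K] by fastforce
        then have "filterlim (\<lambda>n. infdist (rep_projsp x) K * real n) at_top sequentially"
          by (intro filterlim_tendsto_pos_mult_at_top[OF tendsto_const _ filterlim_real_sequentially])
        then have "eventually (\<lambda>n. 1 \<le> infdist (rep_projsp x) K * real n) sequentially"
          by (simp add: filterlim_at_top)
        then show ?thesis by eventually_elim (simp add: f_def mult.commute)
      qed (simp add: f_def)
      then show ?thesis using True by (simp add: tendsto_eventually)
    next
      case False
      then have "rep_projsp x \<in> K" by (simp add: K_def proj_rep rep_projsp_sphere)
      then have "f n x = 0" for n by (auto simp: f_def)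
      then show ?thesis using False by simp
    qed
    have conv: "(\<lambda>n. integral\<^sup>L \<rho> (f n)) \<longlonglongrightarrow> measure \<rho> U"
      if "finite_measure \<rho>" "sets \<rho> = sets borel" for \<rho>
    proof -
      interpret finite_measure \<rho> by fact
      have "(\<lambda>n. integral\<^sup>L \<rho> (f n)) \<longlonglongrightarrow> integral\<^sup>L \<rho> (indicat_real U)"
      proof (rule integral_dominated_convergence[where w = "\<lambda>_. 1"])
        show "f n \<in> borel_measurable \<rho>" for n
          using integrable_continuous_projsp[OF that cont] by auto
        show "AE x in \<rho>. norm (f n x) \<le> 1" for n
          by (auto simp: f_def infdist_nonneg)
      qed (use that U lim in \<open>auto intro!: borel_measurable_indicator\<close>)
      moreover have "integral\<^sup>L \<rho> (indicat_real U) = measure \<rho> U"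
        using U that by simp
      ultimately show ?thesis by simp
    qed
    show ?thesis
      using conv[OF \<mu>] conv[OF \<nu>] eq[OF cont] LIMSEQ_unique by simp
  qed
  show ?thesis
  proof (rule measure_eqI_generator_eq[where E = "{U. open U}" and \<Omega> = UNIV and A = "\<lambda>_. UNIV"])
    show "emeasure \<mu> X = emeasure \<nu> X" if "X \<in> {U. open U}" for X
      using openeq[of X] that \<mu> \<nu> by (simp add: finite_measure.emeasure_eq_measure)
    show "sets \<mu> = sigma_sets UNIV {U. open U}" "sets \<nu> = sigma_sets UNIV {U. open U}"
      using \<mu> \<nu> by (simp_all add: borel_def)
    show "emeasure \<mu> UNIV \<noteq> \<infinity>"
      using \<mu>(1) by (simp add: finite_measure.emeasure_eq_measure)
  qed (auto simp: Int_stable_def)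
qed

section \<open>The distribution of directions of an integrable function\<close>

lemma hom_ext_abs_inner_proj: "hom_ext (abs_inner_proj \<xi>) v = \<bar>\<xi> \<bullet> v\<bar>"
proof (cases "v = 0")
  case False
  then have "\<bar>\<xi> \<bullet> v\<bar> = norm v * \<bar>\<xi> \<bullet> sgn v\<bar>"
    by (simp add: sgn_div_norm abs_mult)
  then show ?thesis
    using False by (simp add: hom_ext_def abs_inner_proj_proj norm_sgn)
qed (simp add: hom_ext_def)

lemma measurable_proj_sgn: "(\<lambda>v :: 'a::euclidean_space. proj (sgn v)) \<in> borel_measurable borel"
proof -
  have "continuous_on (- {0}) (\<lambda>v :: 'a. proj (sgn v))"
  proof (rule continuous_on_compose2[OF continuous_on_proj])
    show "continuous_on (- {0}) (sgn :: 'a \<Rightarrow> 'a)"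
      unfolding sgn_div_norm by (auto intro!: continuous_intros)
  qed (auto simp: norm_sgn split: if_splits)
  then have "(\<lambda>v. if v \<in> - {0} then proj (sgn v) else proj (0 :: 'a)) \<in> borel_measurable borel"
    by (intro borel_measurable_continuous_on_if) auto
  also have "(\<lambda>v. if v \<in> - {0} then proj (sgn v) else proj (0 :: 'a)) = (\<lambda>v. proj (sgn v))"
    by auto
  finally show ?thesis .
qed

text \<open>The measure of the Riesz representation theorem, constructed directly: weigh the parameter space by
the speed \<open>norm (g t)\<close> and push forward along the direction of \<open>g t\<close>.  The direction is a junk value where
\<open>g t = 0\<close>, but there the weight vanishes.\<close>

definition direction_measure :: "'t measure \<Rightarrow> ('t \<Rightarrow> 'a::euclidean_space) \<Rightarrow> 'a projsp measure"
  where "direction_measure M g =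
    distr (density M (\<lambda>t. ennreal (norm (g t)))) borel (\<lambda>t. proj (sgn (g t)))"

context
  fixes M :: "'t measure" and g :: "'t \<Rightarrow> 'a::euclidean_space"
  assumes g: "integrable M g"
begin

lemma sets_direction_measure: "sets (direction_measure M g) = sets borel"
  by (simp add: direction_measure_def)

lemma measurable_direction: "(\<lambda>t. proj (sgn (g t))) \<in> borel_measurable M"
  by (rule measurable_compose[OF _ measurable_proj_sgn]) (use g in auto)

lemma finite_direction_measure: "finite_measure (direction_measure M g)"
proof -
  have [measurable]: "g \<in> borel_measurable M" using g by auto
  have "emeasure (density M (\<lambda>t. ennreal (norm (g t)))) (space M) = (\<integral>\<^sup>+t. ennreal (norm (g t)) \<partial>M)"
    by (subst emeasure_density) (auto intro!: nn_integral_cong)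
  also have "\<dots> < \<infinity>"
    using g by (simp add: integrable_iff_bounded)
  finally have "finite_measure (density M (\<lambda>t. ennreal (norm (g t))))"
    by (intro finite_measureI) auto
  then show ?thesis
    unfolding direction_measure_def
    by (rule finite_measure.finite_measure_distr) (simp add: measurable_direction)
qed

lemma integral_direction_measure:
  assumes f: "continuous_on UNIV f"
  shows "integral\<^sup>L (direction_measure M g) f = (\<integral>t. hom_ext f (g t) \<partial>M)"
proof -
  have [measurable]: "g \<in> borel_measurable M" using g by auto
  have [measurable]: "f \<in> borel_measurable borel" by (rule borel_measurable_continuous_onI[OF f])
  note [measurable] = measurable_direction
  have "integral\<^sup>L (direction_measure M g) f =
      (\<integral>t. f (proj (sgn (g t))) \<partial>density M (\<lambda>t. ennreal (norm (g t))))"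
    unfolding direction_measure_def by (rule integral_distr) (simp_all add: measurable_direction)
  also have "\<dots> = (\<integral>t. hom_ext f (g t) \<partial>M)"
    unfolding hom_ext_def by (subst integral_density) simp_all
  finally show ?thesis .
qed

lemma direction_measure_unique:
  "(THE \<mu>. sets \<mu> = sets borel \<and> finite_measure \<mu> \<and>
      (\<forall>f. continuous_on UNIV f \<longrightarrow> integral\<^sup>L \<mu> f = (\<integral>t. hom_ext f (g t) \<partial>M))) = direction_measure M g"
proof (rule the_equality)
  show "sets (direction_measure M g) = sets borel \<and> finite_measure (direction_measure M g) \<and>
      (\<forall>f. continuous_on UNIV f \<longrightarrow> integral\<^sup>L (direction_measure M g) f = (\<integral>t. hom_ext f (g t) \<partial>M))"
    by (simp add: sets_direction_measure finite_direction_measure integral_direction_measure)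
next
  fix \<mu> :: "'a projsp measure"
  assume "sets \<mu> = sets borel \<and> finite_measure \<mu> \<and>
      (\<forall>f. continuous_on UNIV f \<longrightarrow> integral\<^sup>L \<mu> f = (\<integral>t. hom_ext f (g t) \<partial>M))"
  then show "\<mu> = direction_measure M g"
    by (intro projsp_measure_eqI)
      (auto simp: sets_direction_measure finite_direction_measure integral_direction_measure)
qed

end

section \<open>Integrability of the derivative of an absolutely continuous curve\<close>

lemma abs_cont_curve_imp_continuous_on:
  assumes "abs_cont_curve \<alpha>"
  shows "continuous_on {0..1} \<alpha>"
proof -
  have "\<exists>\<delta>>0. \<forall>x\<in>{0..1}. \<forall>y\<in>{0..1}. x \<le> y \<longrightarrow> y - x < \<delta> \<longrightarrow> norm (\<alpha> y - \<alpha> x) < \<epsilon>"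
    if "0 < \<epsilon>" for \<epsilon>
  proof -
    obtain \<delta> where "0 < \<delta>" and \<delta>: "\<And>(n::nat) a b. (\<forall>i<n. 0 \<le> a i \<and> a i \<le> b i \<and> b i \<le> 1) \<and>
         disjoint_family_on (\<lambda>i. {a i<..<b i}) {..<n} \<and> (\<Sum>i<n. b i - a i) < \<delta> \<Longrightarrow>
         (\<Sum>i<n. norm (\<alpha> (b i) - \<alpha> (a i))) < \<epsilon>"
      using assms \<open>0 < \<epsilon>\<close> unfolding abs_cont_curve_def by blast
    have "norm (\<alpha> y - \<alpha> x) < \<epsilon>" if "x \<in> {0..1}" "y \<in> {0..1}" "x \<le> y" "y - x < \<delta>" for x y
      using \<delta>[of 1 "\<lambda>_. x" "\<lambda>_. y"] that by (simp add: disjoint_family_on_def)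
    then show ?thesis using \<open>0 < \<delta>\<close> by blast
  qed note * = this
  show ?thesis
    unfolding continuous_on_iff
  proof (intro ballI allI impI)
    fix x \<epsilon> :: real assume x: "x \<in> {0..1}" and "0 < \<epsilon>"
    obtain \<delta> where "0 < \<delta>" and \<delta>: "\<And>x y. x \<in> {0..1} \<Longrightarrow> y \<in> {0..1} \<Longrightarrow> x \<le> y \<Longrightarrow> y - x < \<delta> \<Longrightarrow>
        norm (\<alpha> y - \<alpha> x) < \<epsilon>"
      using *[OF \<open>0 < \<epsilon>\<close>] by blast
    have "dist (\<alpha> y) (\<alpha> x) < \<epsilon>" if "y \<in> {0..1}" "dist y x < \<delta>" for y
      using \<delta>[of x y] \<delta>[of y x] x that by (cases "x \<le> y") (auto simp: dist_norm norm_minus_commute)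
    then show "\<exists>d>0. \<forall>x'\<in>{0..1}. dist x' x < d \<longrightarrow> dist (\<alpha> x') (\<alpha> x) < \<epsilon>"
      using \<open>0 < \<delta>\<close> by blast
  qed
qed

text \<open>Extension of a curve beyond \<open>{0..1}\<close> by constants, so that difference quotients make sense at every
parameter.\<close>

definition clamp_curve :: "(real \<Rightarrow> 'a) \<Rightarrow> real \<Rightarrow> 'a"
  where "clamp_curve \<alpha> t = \<alpha> (max 0 (min 1 t))"

lemma continuous_clamp_curve:
  fixes \<alpha> :: "real \<Rightarrow> 'a::topological_space"
  assumes "continuous_on {0..1} \<alpha>"
  shows "continuous_on UNIV (clamp_curve \<alpha>)"
  unfolding clamp_curve_def
  by (rule continuous_on_compose2[OF assms]) (auto intro!: continuous_intros)

text \<open>An absolutely continuous curve has bounded variation; only equally spaced partitions are needed.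
The number \<open>N\<close> is fixed so that \<open>1 / N\<close> is a modulus of absolute continuity for \<open>\<epsilon> = 1\<close>.  A partition
with mesh \<open>1 / (N * m)\<close> then falls into \<open>N\<close> blocks of \<open>m\<close> consecutive intervals, each block contributing
at most 1.\<close>

lemma abs_cont_curve_increments:
  fixes \<alpha> :: "real \<Rightarrow> 'a::euclidean_space"
  assumes "abs_cont_curve \<alpha>"
  obtains N where "0 < N" and "\<And>m s. 0 < m \<Longrightarrow>
    (\<Sum>k<N * m. norm (clamp_curve \<alpha> (s + real (Suc k) / real (N * m)) - clamp_curve \<alpha> (s + real k / real (N * m)))) \<le> real N"
proof -
  obtain \<delta> where "0 < \<delta>" and \<delta>: "\<And>(n::nat) a b. (\<forall>i<n. 0 \<le> a i \<and> a i \<le> b i \<and> b i \<le> 1) \<and>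
       disjoint_family_on (\<lambda>i. {a i<..<b i}) {..<n} \<and> (\<Sum>i<n. b i - a i) < \<delta> \<Longrightarrow>
       (\<Sum>i<n. norm (\<alpha> (b i) - \<alpha> (a i))) < 1"
    using assms unfolding abs_cont_curve_def by (meson zero_less_one)
  obtain N where N: "inverse (real (Suc N)) < \<delta>"
    using reals_Archimedean[OF \<open>0 < \<delta>\<close>] by blast
  show thesis
  proof (rule that[of "Suc N"])
    fix m :: nat and s :: real
    assume m: "0 < m"
    define n where "n = Suc N * m"
    have n: "0 < n" using m by (simp add: n_def)
    define c where "c t = max 0 (min 1 t)" for t :: real
    define p where "p k = c (s + real k / real n)" for k
    have mono: "p k \<le> p l" if "k \<le> l" for k l
    proof -
      have "real k / real n \<le> real l / real n" using that by (simp add: divide_right_mono)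
      then show ?thesis unfolding p_def c_def by linarith
    qed
    have step: "p (Suc k) - p k \<le> 1 / real n" for k
    proof -
      have "s + real (Suc k) / real n = (s + real k / real n) + 1 / real n"
        by (simp add: add_divide_distrib)
      moreover have "0 \<le> 1 / real n" by simp
      ultimately show ?thesis unfolding p_def c_def by linarith
    qed
    have block: "(\<Sum>k\<in>{j * m..<j * m + m}. norm (\<alpha> (p (Suc k)) - \<alpha> (p k))) \<le> 1" for j
    proof -
      have p01: "0 \<le> p k" "p k \<le> 1" for k by (simp_all add: p_def c_def)
      have "(\<Sum>i<m. norm (\<alpha> (p (Suc (j * m + i))) - \<alpha> (p (j * m + i)))) < 1"
      proof (rule \<delta>, intro conjI allI impI)
        show "disjoint_family_on (\<lambda>i. {p (j * m + i)<..<p (Suc (j * m + i))}) {..<m}"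
          unfolding disjoint_family_on_def
        proof (intro ballI impI)
          fix i i' :: nat assume "i \<noteq> i'"
          then consider "Suc (j * m + i) \<le> j * m + i'" | "Suc (j * m + i') \<le> j * m + i" by linarith
          then show "{p (j * m + i)<..<p (Suc (j * m + i))} \<inter> {p (j * m + i')<..<p (Suc (j * m + i'))} = {}"
            by cases (fastforce dest!: mono)+
        qed
        have "(\<Sum>i<m. p (Suc (j * m + i)) - p (j * m + i)) \<le> (\<Sum>i<m. 1 / real n)"
          by (intro sum_mono step)
        also have "\<dots> = inverse (real (Suc N))"
          using m by (simp add: n_def inverse_eq_divide del: of_nat_Suc mult_Suc)
        finally show "(\<Sum>i<m. p (Suc (j * m + i)) - p (j * m + i)) < \<delta>" using N by simp
      qed (simp_all add: p01 mono)
      then show ?thesis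
        by (simp add: sum.atLeastLessThan_shift_0[of _ "j * m"] lessThan_atLeast0)
    qed
    have "(\<Sum>k<n. norm (\<alpha> (p (Suc k)) - \<alpha> (p k))) =
        (\<Sum>j<Suc N. \<Sum>k\<in>{j * m..<j * m + m}. norm (\<alpha> (p (Suc k)) - \<alpha> (p k)))"
      unfolding n_def by (rule sum.nat_group[symmetric])
    also have "\<dots> \<le> (\<Sum>j<Suc N. 1)" by (intro sum_mono block)
    finally show "(\<Sum>k<Suc N * m. norm (clamp_curve \<alpha> (s + real (Suc k) / real (Suc N * m)) -
        clamp_curve \<alpha> (s + real k / real (Suc N * m)))) \<le> real (Suc N)"
      by (simp only: clamp_curve_def p_def c_def n_def) simp
  qed simp
qed

lemma integral_split_equal:
  fixes F :: "real \<Rightarrow> real"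
  assumes F: "continuous_on UNIV F" and h: "0 \<le> h"
  shows "integral {0..real m * h} F = integral {0..h} (\<lambda>s. \<Sum>k<m. F (s + real k * h))"
proof (induction m)
  case 0
  then show ?case by simp
next
  case (Suc m)
  have int: "F integrable_on {a..b}" for a b
    by (rule integrable_continuous_real[OF continuous_on_subset[OF F]]) simp
  have cont: "continuous_on {0..h} (\<lambda>s. F (s + real k * h))" for k
    by (rule continuous_on_compose2[OF F]) (auto intro!: continuous_intros)
  have "integral {0..real (Suc m) * h} F = integral {0..real m * h} F + integral {real m * h..real (Suc m) * h} F"
    by (rule Henstock_Kurzweil_Integration.integral_combine[symmetric])
      (use h int in \<open>auto simp: mult_right_mono\<close>)
  also have "integral {real m * h..real (Suc m) * h} F = integral {0..h} (\<lambda>s. F (s + real m * h))"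
    using integral_shift[OF continuous_on_subset[OF F subset_UNIV], of 0 h "real m * h"]
    by (simp add: o_def algebra_simps)
  finally show ?case
    unfolding Suc.IH sum.lessThan_Suc
    by (subst Henstock_Kurzweil_Integration.integral_add)
      (auto intro!: integrable_continuous_real continuous_on_sum cont)
qed

text \<open>Cutting \<open>{0..1}\<close> into pieces of length \<open>1 / n\<close> and moving them all to \<open>{0..1 / n}\<close> turns the integral of
the difference quotient into an average of increment sums over equally spaced partitions.\<close>

lemma abs_cont_curve_difference_quotients:
  fixes \<alpha> :: "real \<Rightarrow> 'a::euclidean_space"
  assumes "abs_cont_curve \<alpha>"
  obtains N where "0 < N" and "\<And>m. 0 < m \<Longrightarrow>
    integral {0..1} (\<lambda>t. real (N * m) * norm (clamp_curve \<alpha> (t + 1 / real (N * m)) - clamp_curve \<alpha> t)) \<le> real N"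
proof -
  obtain N where N: "0 < N" and sum: "\<And>m s. 0 < m \<Longrightarrow>
    (\<Sum>k<N * m. norm (clamp_curve \<alpha> (s + real (Suc k) / real (N * m)) - clamp_curve \<alpha> (s + real k / real (N * m)))) \<le> real N"
    using abs_cont_curve_increments[OF assms] by blast
  have a: "continuous_on UNIV (clamp_curve \<alpha>)"
    by (intro continuous_clamp_curve abs_cont_curve_imp_continuous_on assms)
  show thesis
  proof (rule that[OF N])
    fix m :: nat assume m: "0 < m"
    define n where "n = N * m"
    have n: "0 < n" using N m by (simp add: n_def)
    define F where "F t = real n * norm (clamp_curve \<alpha> (t + 1 / real n) - clamp_curve \<alpha> t)" for t
    have F: "continuous_on UNIV F"
      unfolding F_def by (intro continuous_intros continuous_on_compose2[OF a]) auto
    have "integral {0..1} F = integral {0..real n * (1 / real n)} F" using n by simp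
    also have "\<dots> = integral {0..1 / real n} (\<lambda>s. \<Sum>k<n. F (s + real k * (1 / real n)))"
      by (rule integral_split_equal[OF F]) simp
    also have "\<dots> \<le> integral {0..1 / real n} (\<lambda>s. real n * real N)"
    proof (rule integral_le)
      show "(\<lambda>s. \<Sum>k<n. F (s + real k * (1 / real n))) integrable_on {0..1 / real n}"
        by (intro integrable_continuous_real continuous_on_sum continuous_on_compose2[OF F])
          (auto intro!: continuous_intros)
      fix s :: real
      have "(\<Sum>k<n. F (s + real k * (1 / real n))) = real n *
          (\<Sum>k<n. norm (clamp_curve \<alpha> (s + real (Suc k) / real n) - clamp_curve \<alpha> (s + real k / real n)))"
        by (simp add: F_def sum_distrib_left add_divide_distrib add_ac)
      also have "\<dots> \<le> real n * real N"
        using sum[OF m, of s] by (intro mult_left_mono) (simp_all only: n_def of_nat_0_le_iff)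
      finally show "(\<Sum>k<n. F (s + real k * (1 / real n))) \<le> real n * real N" .
    qed (rule integrable_const_ivl)
    also have "\<dots> = real N" using n by simp
    finally show "integral {0..1} (\<lambda>t. real (N * m) * norm (clamp_curve \<alpha> (t + 1 / real (N * m)) - clamp_curve \<alpha> t)) \<le> real N"
      unfolding F_def n_def .
  qed
qed

lemma has_vector_derivative_difference_quotient:
  fixes a :: "real \<Rightarrow> 'a::real_normed_vector"
  shows "(a has_vector_derivative d) (at t) \<longleftrightarrow> ((\<lambda>h. (a (t + h) - a t) /\<^sub>R h) \<longlongrightarrow> d) (at 0)"
proof -
  have "norm (a (t + h) - a t - h *\<^sub>R d) / norm h = norm ((a (t + h) - a t) /\<^sub>R h - d)" if "h \<noteq> 0" for h
  proof -
    have "(a (t + h) - a t) /\<^sub>R h - d = (a (t + h) - a t - h *\<^sub>R d) /\<^sub>R h"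
      using that by (simp add: scaleR_diff_right)
    then show ?thesis by (simp add: divide_inverse_commute)
  qed
  then have "((\<lambda>h. norm (a (t + h) - a t - h *\<^sub>R d) / norm h) \<longlongrightarrow> 0) (at 0) \<longleftrightarrow>
      ((\<lambda>h. norm ((a (t + h) - a t) /\<^sub>R h - d)) \<longlongrightarrow> 0) (at 0)"
    by (intro Lim_cong_within) auto
  also have "\<dots> \<longleftrightarrow> ((\<lambda>h. (a (t + h) - a t) /\<^sub>R h) \<longlongrightarrow> d) (at 0)"
    by (simp only: tendsto_norm_zero_iff Lim_null[symmetric])
  finally show ?thesis
    by (simp add: has_vector_derivative_def has_derivative_at bounded_linear_scaleR_left)
qed

text \<open>The Cauchy criterion describes differentiability without naming the derivative, by inequalities
that are closed conditions on the point once the increments \<open>h\<close> and \<open>k\<close> are fixed.\<close>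

lemma differentiable_Cauchy:
  fixes a :: "real \<Rightarrow> 'a::banach"
  shows "(\<exists>d. (a has_vector_derivative d) (at t)) \<longleftrightarrow>
    (\<forall>i. \<exists>j. \<forall>h k. h \<noteq> 0 \<longrightarrow> k \<noteq> 0 \<longrightarrow> \<bar>h\<bar> < inverse (Suc j) \<longrightarrow> \<bar>k\<bar> < inverse (Suc j) \<longrightarrow>
      norm ((a (t + h) - a t) /\<^sub>R h - (a (t + k) - a t) /\<^sub>R k) \<le> inverse (Suc i))"
    (is "?L \<longleftrightarrow> ?R")
proof
  let ?q = "\<lambda>h. (a (t + h) - a t) /\<^sub>R h"
  assume ?L
  then obtain d where d: "(?q \<longlongrightarrow> d) (at 0)"
    by (auto simp: has_vector_derivative_difference_quotient)
  show ?R
  proof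
    fix i
    have pos: "0 < inverse (real (Suc i)) / 2" by simp
    have "\<exists>\<delta>>0. \<forall>h. h \<noteq> 0 \<and> \<bar>h\<bar> < \<delta> \<longrightarrow> dist (?q h) d < inverse (real (Suc i)) / 2"
      using tendstoD[OF d pos] unfolding eventually_at by (simp del: of_nat_Suc)
    then obtain \<delta> where "0 < \<delta>" and \<delta>: "\<And>h. h \<noteq> 0 \<Longrightarrow> \<bar>h\<bar> < \<delta> \<Longrightarrow> dist (?q h) d < inverse (real (Suc i)) / 2"
      by blast
    obtain j where j: "inverse (real (Suc j)) < \<delta>" using reals_Archimedean[OF \<open>0 < \<delta>\<close>] by blast
    have "norm (?q h - ?q k) \<le> inverse (Suc i)"
      if "h \<noteq> 0" "k \<noteq> 0" "\<bar>h\<bar> < inverse (Suc j)" "\<bar>k\<bar> < inverse (Suc j)" for h k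
    proof -
      have "dist (?q h) d < inverse (real (Suc i)) / 2" "dist (?q k) d < inverse (real (Suc i)) / 2"
        using that j \<delta>[of h] \<delta>[of k] by linarith+
      then have "dist (?q h) (?q k) < inverse (real (Suc i))"
        by (rule dist_triangle_half_l)
      then show ?thesis by (simp only: dist_norm less_imp_le)
    qed
    then show "\<exists>j. \<forall>h k. h \<noteq> 0 \<longrightarrow> k \<noteq> 0 \<longrightarrow> \<bar>h\<bar> < inverse (Suc j) \<longrightarrow> \<bar>k\<bar> < inverse (Suc j) \<longrightarrow>
      norm (?q h - ?q k) \<le> inverse (Suc i)" by blast
  qed
next
  let ?q = "\<lambda>h. (a (t + h) - a t) /\<^sub>R h"
  assume R: ?R
  have "\<exists>d. (?q \<longlongrightarrow> d) (at 0)"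
  proof -
    have "\<exists>P. eventually P (at 0) \<and> (\<forall>h k. P h \<and> P k \<longrightarrow> dist (?q h) (?q k) < e)" if "0 < e" for e
    proof -
      obtain i where i: "inverse (real (Suc i)) < e" using reals_Archimedean[OF \<open>0 < e\<close>] by blast
      obtain j where j: "\<And>h k. h \<noteq> 0 \<Longrightarrow> k \<noteq> 0 \<Longrightarrow> \<bar>h\<bar> < inverse (Suc j) \<Longrightarrow> \<bar>k\<bar> < inverse (Suc j) \<Longrightarrow>
        norm (?q h - ?q k) \<le> inverse (Suc i)"
        using R by blast
      have "eventually (\<lambda>h. h \<noteq> 0 \<and> \<bar>h\<bar> < inverse (real (Suc j))) (at 0)"
        unfolding eventually_at by (intro exI[of _ "inverse (real (Suc j))"]) (auto simp: dist_real_def)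
      then show ?thesis
        using i j by (intro exI[of _ "\<lambda>h. h \<noteq> 0 \<and> \<bar>h\<bar> < inverse (real (Suc j))"])
          (auto simp: dist_norm intro: le_less_trans)
    qed
    then have "cauchy_filter (filtermap ?q (at 0))"
      unfolding cauchy_filter_metric_filtermap by blast
    then show ?thesis
      using cauchy_filter_complete_converges[OF _ complete_UNIV, of "filtermap ?q (at 0)"]
      by (auto simp: filterlim_def filtermap_bot_iff)
  qed
  then show ?L by (auto simp: has_vector_derivative_difference_quotient)
qed

lemma differentiability_set_borel:
  fixes a :: "real \<Rightarrow> 'a::banach"
  assumes a: "continuous_on UNIV a"
  shows "{t. \<exists>d. (a has_vector_derivative d) (at t)} \<in> sets borel"
proof -
  let ?q = "\<lambda>t h. (a (t + h) - a t) /\<^sub>R h"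
  define C where "C i j = {t. \<forall>h k. h \<noteq> 0 \<longrightarrow> k \<noteq> 0 \<longrightarrow> \<bar>h\<bar> < inverse (Suc j) \<longrightarrow>
    \<bar>k\<bar> < inverse (Suc j) \<longrightarrow> norm (?q t h - ?q t k) \<le> inverse (Suc i)}" for i j :: nat
  have "continuous_on UNIV (\<lambda>t. norm (?q t h - ?q t k))" for h k
    by (intro continuous_intros continuous_on_compose2[OF a]) auto
  then have "closed (C i j)" for i j
    unfolding C_def by (intro closed_Collect_all closed_Collect_imp closed_Collect_le open_Collect_const) auto
  then have "(\<Inter>i. \<Union>j. C i j) \<in> sets borel"
    by (intro sets.countable_INT'' sets.countable_UN'') auto
  also have "(\<Inter>i. \<Union>j. C i j) = {t. \<exists>d. (a has_vector_derivative d) (at t)}"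
    by (auto simp: differentiable_Cauchy C_def)
  finally show ?thesis .
qed

lemma curve_deriv_clamp:
  assumes t: "t \<in> {0<..<1}"
  shows "curve_deriv \<alpha> t = vector_derivative (clamp_curve \<alpha>) (at t)"
proof -
  have "(\<alpha> has_vector_derivative d) (at t) \<longleftrightarrow> (clamp_curve \<alpha> has_vector_derivative d) (at t)" for d
    using has_vector_derivative_transform_within_open[of \<alpha> d t "{0<..<1}" "clamp_curve \<alpha>"]
      has_vector_derivative_transform_within_open[of "clamp_curve \<alpha>" d t "{0<..<1}" \<alpha>] t
    by (auto simp: clamp_curve_def)
  then show ?thesis
    using t by (simp add: curve_deriv_def vector_derivative_def at_within_Icc_at)
qed

text \<open>On the Borel set \<open>D\<close> of points of differentiability, Fatou's lemma bounds the integral of the speed by the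
integrals of the difference quotients.  Off \<open>D\<close> the choice operator behind \<^const>\<open>vector_derivative\<close>
returns one and the same vector \<open>c0\<close> everywhere, which is integrable over a bounded interval.\<close>

lemma curve_deriv_integrable:
  fixes \<alpha> :: "real \<Rightarrow> 'a::euclidean_space"
  assumes "abs_cont_curve \<alpha>"
  shows "integrable (lebesgue_on {0..1}) (curve_deriv \<alpha>)"
proof -
  let ?L = "lebesgue_on {0..1::real}"
  have borelL: "f \<in> borel_measurable ?L" if "f \<in> borel_measurable borel" for f :: "real \<Rightarrow> 'b::topological_space"
    by (intro measurable_restrict_space1 measurable_completion) (use that in simp)
  define a where "a = clamp_curve \<alpha>"
  obtain N where N: "0 < N" and quot: "\<And>m. 0 < m \<Longrightarrow>
    integral {0..1} (\<lambda>t. real (N * m) * norm (a (t + 1 / real (N * m)) - a t)) \<le> real N"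
    using abs_cont_curve_difference_quotients[OF assms] unfolding a_def by blast
  have a: "continuous_on UNIV a"
    unfolding a_def by (intro continuous_clamp_curve abs_cont_curve_imp_continuous_on assms)
  define n where "n m = N * Suc m" for m
  have n: "0 < n m" for m using N by (simp add: n_def)
  define q where "q m t = real (n m) *\<^sub>R (a (t + 1 / real (n m)) - a t)" for m t
  have q: "continuous_on UNIV (q m)" for m
    unfolding q_def by (intro continuous_intros continuous_on_compose2[OF a]) auto
  define D where "D = {t. \<exists>d. (a has_vector_derivative d) (at t)}"
  have D: "D \<in> sets borel" unfolding D_def by (rule differentiability_set_borel[OF a])
  define c0 :: 'a where "c0 = (SOME d. False)"
  define G where "G t = (if t \<in> D then lim (\<lambda>m. q m t) else c0)" for t
  have [measurable]: "q m \<in> borel_measurable borel" for m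
    by (rule borel_measurable_continuous_onI[OF q])
  have Gb [measurable]: "G \<in> borel_measurable borel"
    unfolding G_def using D by (intro measurable_If_set borel_measurable_lim_metric) auto
  then have G: "G \<in> borel_measurable ?L"
    by (rule borelL)
  have lim: "(\<lambda>m. q m t) \<longlonglongrightarrow> d" if "(a has_vector_derivative d) (at t)" for t d
  proof -
    have "filterlim (\<lambda>m. 1 / real (n m)) (at 0) sequentially"
    proof (rule filterlim_atI)
      have "filterlim (\<lambda>m. real N * real (Suc m)) at_top sequentially"
        using N by (intro filterlim_tendsto_pos_mult_at_top[OF tendsto_const]
            filterlim_compose[OF filterlim_real_sequentially filterlim_Suc]) auto
      then show "(\<lambda>m. 1 / real (n m)) \<longlonglongrightarrow> 0"
        unfolding n_def of_nat_mult
        by (intro tendsto_divide_0[OF tendsto_const] filterlim_at_top_imp_at_infinity)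
    qed (use n in simp)
    from filterlim_compose[OF that[unfolded has_vector_derivative_difference_quotient] this]
    show ?thesis by (simp add: q_def)
  qed
  have GD: "curve_deriv \<alpha> t = G t" if "t \<in> {0<..<1}" for t
  proof (cases "t \<in> D")
    case True
    then obtain d where d: "(a has_vector_derivative d) (at t)" by (auto simp: D_def)
    show ?thesis
      using curve_deriv_clamp[OF that, of \<alpha>] vector_derivative_at[OF d] limI[OF lim[OF d]] True
      by (simp add: G_def a_def)
  next
    case False
    then have "\<not> (a has_vector_derivative d) (at t)" for d by (auto simp: D_def)
    then have "vector_derivative a (at t) = c0"
      by (simp add: vector_derivative_def c0_def)
    then show ?thesis
      using curve_deriv_clamp[OF that, of \<alpha>] False by (simp add: G_def a_def)
  qed
  have ends: "negligible {0, 1 :: real}" by simp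
  have ae: "AE t in ?L. G t = curve_deriv \<alpha> t"
  proof -
    have "G t = curve_deriv \<alpha> t" if "t \<in> {0..1}" "t \<notin> {0, 1}" for t
      using GD[of t] that by auto
    then have "AE t in lebesgue. t \<in> {0..1} \<longrightarrow> G t = curve_deriv \<alpha> t"
      by (intro AE_I'[OF ends[unfolded negligible_iff_null_sets]]) blast
    then show ?thesis by (simp add: AE_restrict_space_iff)
  qed
  have "integrable ?L G"
  proof (rule integrableI_bounded[OF G])
    have "(\<integral>\<^sup>+t. ennreal (norm (G t)) \<partial>?L) \<le> (\<integral>\<^sup>+t. liminf (\<lambda>m. ennreal (norm (q m t))) + ennreal (norm c0) \<partial>?L)"
    proof (rule nn_integral_mono)
      fix t
      show "ennreal (norm (G t)) \<le> liminf (\<lambda>m. ennreal (norm (q m t))) + ennreal (norm c0)"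
      proof (cases "t \<in> D")
        case True
        then obtain d where d: "(a has_vector_derivative d) (at t)" by (auto simp: D_def)
        have "(\<lambda>m. ennreal (norm (q m t))) \<longlonglongrightarrow> ennreal (norm (G t))"
          using lim[OF d] limI[OF lim[OF d]] True by (auto simp: G_def intro!: tendsto_intros)
        then have "liminf (\<lambda>m. ennreal (norm (q m t))) = ennreal (norm (G t))"
          by (intro lim_imp_Liminf) auto
        then show ?thesis by simp
      qed (simp add: G_def)
    qed
    also have "\<dots> = (\<integral>\<^sup>+t. liminf (\<lambda>m. ennreal (norm (q m t))) \<partial>?L) + ennreal (norm c0)"
      by (subst nn_integral_add) (auto intro!: borelL simp: emeasure_restrict_space)
    also have "(\<integral>\<^sup>+t. liminf (\<lambda>m. ennreal (norm (q m t))) \<partial>?L) \<le> liminf (\<lambda>m. \<integral>\<^sup>+t. ennreal (norm (q m t)) \<partial>?L)"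
      by (rule nn_integral_liminf) (auto intro!: borelL)
    also have "\<dots> \<le> liminf (\<lambda>m. ennreal (real N))"
    proof (intro Liminf_mono always_eventually allI)
      fix m
      have int: "integrable ?L (\<lambda>t. norm (q m t))"
        by (intro continuous_imp_integrable_real continuous_on_norm continuous_on_subset[OF q]) simp
      have "(\<integral>\<^sup>+t. ennreal (norm (q m t)) \<partial>?L) = ennreal (integral {0..1} (\<lambda>t. norm (q m t)))"
        using nn_integral_eq_integral[OF int] lebesgue_integral_eq_integral[OF int] by simp
      also have "\<dots> \<le> ennreal (real N)"
        using quot[of "Suc m"] by (simp add: q_def n_def)
      finally show "(\<integral>\<^sup>+t. ennreal (norm (q m t)) \<partial>?L) \<le> ennreal (real N)" .
    qed
    finally show "(\<integral>\<^sup>+t. ennreal (norm (G t)) \<partial>?L) < \<infinity>"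
      by (auto simp: Liminf_const intro: le_less_trans)
  qed
  moreover have "curve_deriv \<alpha> \<in> borel_measurable ?L"
  proof -
    have "(\<lambda>t. if t = 0 then curve_deriv \<alpha> 0 else if t = 1 then curve_deriv \<alpha> 1 else G t) \<in> borel_measurable ?L"
      by (rule borelL) measurable
    also have "?this \<longleftrightarrow> ?thesis"
      by (intro measurable_cong) (auto simp: GD)
    finally show ?thesis .
  qed
  ultimately show ?thesis
    using ae by (rule integrable_cong_AE_imp) 
qed

section \<open>Gaussian averages of the cosine transform\<close>

text \<open>A linear combination of independent standard normal variables is normal with variance the sum of
the squared coefficients, and the absolute first moment of a centred normal variable is
\<open>sqrt (2 / pi)\<close> times its standard deviation.\<close>

lemma gaussian_abs_inner:
  fixes c :: "'i \<Rightarrow> real"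
  assumes I: "finite I"
  shows "has_bochner_integral (Pi\<^sub>M I (\<lambda>_. density lborel std_normal_density))
           (\<lambda>z. \<bar>\<Sum>i\<in>I. z i * c i\<bar>) (sqrt (2 / pi) * sqrt (\<Sum>i\<in>I. (c i)\<^sup>2))"
proof -
  let ?N = "density lborel std_normal_density :: real measure"
  let ?P = "Pi\<^sub>M I (\<lambda>_. ?N)"
  interpret N: prob_space ?N by (rule prob_space_normal_density) simp
  interpret P: prob_space ?P by (rule prob_space_PiM) (rule N.prob_space_axioms)
  \<comment> \<open>A normal density of variance 0 does not exist, so vanishing coefficients are dropped first.\<close>
  define J where "J = {i \<in> I. c i \<noteq> 0}"
  have J: "finite J" "J \<subseteq> I" using I by (auto simp: J_def)
  have sums: "(\<Sum>i\<in>I. z i * c i) = (\<Sum>i\<in>J. z i * c i)" for z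
    by (rule sum.mono_neutral_right) (use I in \<open>auto simp: J_def\<close>)
  have sums2: "(\<Sum>i\<in>I. (c i)\<^sup>2) = (\<Sum>i\<in>J. \<bar>c i\<bar>\<^sup>2)"
    by (simp, rule sum.mono_neutral_right) (use I in \<open>auto simp: J_def\<close>)
  show ?thesis
  proof (cases "J = {}")
    case True
    then show ?thesis by (simp add: sums sums2 has_bochner_integral_zero)
  next
    case False
    have coord: "distributed ?P lborel (\<lambda>z. z i) std_normal_density" if "i \<in> I" for i
      unfolding distributed_def
    proof (intro conjI)
      have "distr ?P lborel (\<lambda>z. z i) = distr ?P ?N (\<lambda>z. z i)"
        by (rule distr_cong) auto
      also have "\<dots> = ?N"
        using distr_PiM_component[of I "\<lambda>_. ?N" i] that N.prob_space_axioms by simp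
      finally show "distr ?P lborel (\<lambda>z. z i) = ?N" .
      have "(\<lambda>z. z i) \<in> measurable ?P ?N"
        using that by (rule measurable_component_singleton)
      then show "(\<lambda>z. z i) \<in> measurable ?P lborel" by simp
    qed auto
    have "P.indep_vars (\<lambda>_. borel) (\<lambda>i z. z i * c i) J"
    proof -
      have "P.indep_vars (\<lambda>_. ?N) (\<lambda>i z. z i) I"
      proof (subst P.indep_vars_iff_distr_eq_PiM')
        show "I \<noteq> {}" using False J by auto
        show "(\<lambda>z. z i) \<in> measurable ?P ?N" if "i \<in> I" for i
          using that by (rule measurable_component_singleton)
        have "distr ?P ?P (\<lambda>x. \<lambda>i\<in>I. x i) = distr ?P ?P (\<lambda>x. x)"
          by (rule distr_cong) (auto simp: space_PiM)
        also have "\<dots> = ?P" by (rule distr_id)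
        also have "\<dots> = Pi\<^sub>M I (\<lambda>i. distr ?P ?N (\<lambda>z. z i))"
          by (intro PiM_cong refl distr_PiM_component[symmetric]) (use N.prob_space_axioms in auto)
        finally show "distr ?P ?P (\<lambda>x. \<lambda>i\<in>I. x i) = Pi\<^sub>M I (\<lambda>i. distr ?P ?N (\<lambda>z. z i))" .
      qed
      then have "P.indep_vars (\<lambda>_. borel) (\<lambda>i z. (\<lambda>x. x * c i) (z i)) I"
        by (rule P.indep_vars_compose2) simp
      then show ?thesis using J P.indep_vars_subset by blast
    qed
    moreover have "distributed ?P lborel (\<lambda>z. z i * c i) (normal_density 0 \<bar>c i\<bar>)" if "i \<in> J" for i
      using P.normal_density_affine[OF coord[of i], of "c i" 0] that by (simp add: J_def mult.commute)
    ultimately have D: "distributed ?P lborel (\<lambda>z. \<Sum>i\<in>J. z i * c i)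
        (normal_density 0 (sqrt (\<Sum>i\<in>J. \<bar>c i\<bar>\<^sup>2)))"
      using P.sum_indep_normal[of J "\<lambda>i z. z i * c i" "\<lambda>i. \<bar>c i\<bar>" "\<lambda>_. 0"] J False
      by (simp add: J_def)
    define \<sigma> where "\<sigma> = sqrt (\<Sum>i\<in>J. \<bar>c i\<bar>\<^sup>2)"
    have "\<sigma> > 0"
      using False J by (auto simp: \<sigma>_def J_def intro!: real_sqrt_gt_zero sum_pos)
    then have nm: "has_bochner_integral lborel (\<lambda>x. normal_density 0 \<sigma> x * \<bar>x\<bar>) (\<sigma> * sqrt (2 / pi))"
      using normal_moment_abs_odd[where k = 0 and \<mu> = 0 and \<sigma> = \<sigma>] by simp
    have "integral\<^sup>L lborel (\<lambda>x. normal_density 0 \<sigma> x * \<bar>x\<bar>) = (\<integral>z. \<bar>\<Sum>i\<in>J. z i * c i\<bar> \<partial>?P)"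
      using distributed_integral[OF D[folded \<sigma>_def], of abs] by simp
    moreover have "integrable lborel (\<lambda>x. normal_density 0 \<sigma> x * \<bar>x\<bar>) = integrable ?P (\<lambda>z. \<bar>\<Sum>i\<in>J. z i * c i\<bar>)"
      using distributed_integrable[OF D[folded \<sigma>_def], of abs] by simp
    ultimately show ?thesis
      using nm by (simp add: has_bochner_integral_iff sums sums2 \<sigma>_def mult.commute)
  qed
qed

text \<open>Averaging the data \<open>\<integral>\<bar>\<xi> \<bullet> g\<bar>\<close> over a Gaussian vector \<open>\<xi>\<close> with covariance \<open>\<Sum>i. p i p i\<^sup>T\<close> replaces the
kink of the absolute value by the square root of a positive quadratic form.\<close>

lemma gaussian_average:
  fixes g :: "'t \<Rightarrow> 'a::euclidean_space" and p :: "'i \<Rightarrow> 'a"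
  assumes M: "sigma_finite_measure M" and g: "integrable M g" and I: "finite I"
  shows "(\<integral>z. (\<integral>t. \<bar>(\<Sum>i\<in>I. z i *\<^sub>R p i) \<bullet> g t\<bar> \<partial>M) \<partial>Pi\<^sub>M I (\<lambda>_. density lborel std_normal_density)) =
         sqrt (2 / pi) * (\<integral>t. sqrt (\<Sum>i\<in>I. (p i \<bullet> g t)\<^sup>2) \<partial>M)"
proof -
  let ?N = "density lborel std_normal_density :: real measure"
  let ?P = "Pi\<^sub>M I (\<lambda>_. ?N)"
  interpret M: sigma_finite_measure M by (rule M)
  interpret N: prob_space ?N by (rule prob_space_normal_density) simp
  interpret P: prob_space ?P by (rule prob_space_PiM) (rule N.prob_space_axioms)
  interpret MP: pair_sigma_finite M ?P ..
  have gm [measurable]: "g \<in> borel_measurable M" using g by auto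
  define F where "F = (\<lambda>t z. \<bar>(\<Sum>i\<in>I. z i *\<^sub>R p i) \<bullet> g t\<bar>)"
  have F: "has_bochner_integral ?P (F t) (sqrt (2 / pi) * sqrt (\<Sum>i\<in>I. (p i \<bullet> g t)\<^sup>2))" for t
    using gaussian_abs_inner[OF I, of "\<lambda>i. p i \<bullet> g t"] by (simp add: F_def inner_sum_left)
  have coord [measurable]: "(\<lambda>x. snd x i) \<in> borel_measurable (M \<Otimes>\<^sub>M ?P)" if "i \<in> I" for i
  proof -
    have "(\<lambda>z. z i) \<in> borel_measurable ?P"
      using measurable_component_singleton[OF that, of "\<lambda>_. ?N"] by simp
    then show ?thesis by measurable
  qed
  have "integrable (M \<Otimes>\<^sub>M ?P) (case_prod F)"
  proof (rule MP.Fubini_integrable)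
    show "case_prod F \<in> borel_measurable (M \<Otimes>\<^sub>M ?P)"
      unfolding F_def case_prod_beta by measurable
    show "AE t in M. integrable ?P (\<lambda>z. case_prod F (t, z))"
      using F by (simp add: has_bochner_integral_iff)
    have "integrable M (\<lambda>t. sqrt (\<Sum>i\<in>I. (p i \<bullet> g t)\<^sup>2))"
    proof (rule Bochner_Integration.integrable_bound)
      show "integrable M (\<lambda>t. (\<Sum>i\<in>I. norm (p i)) * norm (g t))"
        using g by auto
      show "AE t in M. norm (sqrt (\<Sum>i\<in>I. (p i \<bullet> g t)\<^sup>2)) \<le> norm ((\<Sum>i\<in>I. norm (p i)) * norm (g t))"
      proof (rule AE_I2)
        fix t
        have "sqrt (\<Sum>i\<in>I. (p i \<bullet> g t)\<^sup>2) \<le> (\<Sum>i\<in>I. \<bar>p i \<bullet> g t\<bar>)"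
          using L2_set_le_sum_abs[of "\<lambda>i. p i \<bullet> g t" I] by (simp add: L2_set_def)
        also have "\<dots> \<le> (\<Sum>i\<in>I. norm (p i)) * norm (g t)"
          unfolding sum_distrib_right by (intro sum_mono Cauchy_Schwarz_ineq2)
        finally show "norm (sqrt (\<Sum>i\<in>I. (p i \<bullet> g t)\<^sup>2)) \<le> norm ((\<Sum>i\<in>I. norm (p i)) * norm (g t))"
          by (simp add: sum_nonneg)
      qed
    qed measurable
    then have "integrable M (\<lambda>t. sqrt (2 / pi) * sqrt (\<Sum>i\<in>I. (p i \<bullet> g t)\<^sup>2))"
      by (rule integrable_mult_right)
    moreover have "(\<integral>z. norm (F t z) \<partial>?P) = sqrt (2 / pi) * sqrt (\<Sum>i\<in>I. (p i \<bullet> g t)\<^sup>2)" for t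
      using F[of t] by (simp add: has_bochner_integral_iff F_def)
    ultimately show "integrable M (\<lambda>t. \<integral>z. norm (case_prod F (t, z)) \<partial>?P)"
      by simp
  qed
  then have "(\<integral>z. (\<integral>t. F t z \<partial>M) \<partial>?P) = (\<integral>t. (\<integral>z. F t z \<partial>?P) \<partial>M)"
    by (rule MP.Fubini_integral)
  also have "\<dots> = (\<integral>t. sqrt (2 / pi) * sqrt (\<Sum>i\<in>I. (p i \<bullet> g t)\<^sup>2) \<partial>M)"
    using F by (simp add: has_bochner_integral_iff)
  finally show ?thesis by (simp add: F_def)
qed

text \<open>Choosing the covariance \<open>1 + \<tau> w w\<^sup>T\<close> in the Gaussian average.  The Gaussian vector has one coordinate
for each basis vector and one more, indexed by 0, in the direction \<open>w\<close>.\<close>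

lemma rank_one_perturbation:
  fixes g h :: "'t \<Rightarrow> 'a::euclidean_space"
  assumes M: "sigma_finite_measure M" and g: "integrable M g" and h: "integrable M h"
    and eq: "\<And>\<xi>. (\<integral>t. \<bar>\<xi> \<bullet> g t\<bar> \<partial>M) = (\<integral>t. \<bar>\<xi> \<bullet> h t\<bar> \<partial>M)" and \<tau>: "0 \<le> \<tau>"
  shows "(\<integral>t. sqrt ((norm (g t))\<^sup>2 + \<tau> * (w \<bullet> g t)\<^sup>2) \<partial>M) = (\<integral>t. sqrt ((norm (h t))\<^sup>2 + \<tau> * (w \<bullet> h t)\<^sup>2) \<partial>M)"
proof -
  let ?I = "insert 0 Basis :: 'a set"
  define p where "p = (\<lambda>b. if b = 0 then sqrt \<tau> *\<^sub>R w else b)"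
  have p: "(\<Sum>b\<in>?I. (p b \<bullet> v)\<^sup>2) = (norm v)\<^sup>2 + \<tau> * (w \<bullet> v)\<^sup>2" for v
  proof -
    have "(\<Sum>b\<in>Basis. (p b \<bullet> v)\<^sup>2) = (\<Sum>b\<in>Basis. (v \<bullet> b)\<^sup>2)"
      by (intro sum.cong refl) (auto simp: p_def inner_commute)
    also have "\<dots> = (norm v)\<^sup>2"
      unfolding power2_norm_eq_inner by (subst euclidean_inner) (simp add: power2_eq_square)
    finally show ?thesis
      using \<tau> by (simp add: p_def power_mult_distrib)
  qed
  have "sqrt (2 / pi) * (\<integral>t. sqrt (\<Sum>b\<in>?I. (p b \<bullet> g t)\<^sup>2) \<partial>M) =
        sqrt (2 / pi) * (\<integral>t. sqrt (\<Sum>b\<in>?I. (p b \<bullet> h t)\<^sup>2) \<partial>M)"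
    unfolding gaussian_average[OF M g, of ?I p, symmetric, simplified finite_insert, OF finite_Basis]
      gaussian_average[OF M h, of ?I p, symmetric, simplified finite_insert, OF finite_Basis] eq ..
  then show ?thesis by (simp add: p)
qed

section \<open>Injectivity of the cosine transform\<close>

text \<open>Agreement on the positive side of 0 suffices, as a nonzero power series has no zeros accumulating at
its centre.  The one-sided form is needed because the parameter \<open>\<tau>\<close> of the covariance \<open>1 + \<tau> w w\<^sup>T\<close> is
nonnegative.\<close>

lemma powser_coeff_unique:
  fixes a b :: "nat \<Rightarrow> real"
  assumes r: "0 < r"
    and a: "\<And>x. 0 < x \<Longrightarrow> x < r \<Longrightarrow> (\<lambda>n. a n * x ^ n) sums s x"
    and b: "\<And>x. 0 < x \<Longrightarrow> x < r \<Longrightarrow> (\<lambda>n. b n * x ^ n) sums s x"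
  shows "a n = b n"
proof (induction n rule: less_induct)
  case (less n)
  define d where "d k = a (k + n) - b (k + n)" for k
  have d: "(\<lambda>k. d k * x ^ k) sums 0" if x: "0 < x" "x < r" for x
  proof -
    have "(\<lambda>k. (a k - b k) * x ^ k) sums 0"
      using sums_diff[OF a[OF x] b[OF x]] by (simp add: algebra_simps)
    then have "(\<lambda>k. (a (k + n) - b (k + n)) * x ^ (k + n)) sums 0"
      by (subst sums_zero_iff_shift) (use less in auto)
    then have "(\<lambda>k. x ^ n * (d k * x ^ k)) sums (x ^ n * 0)"
      by (simp add: d_def power_add mult_ac)
    then show ?thesis
      using x by (subst (asm) sums_mult_iff) auto
  qed
  have "((\<lambda>x. \<Sum>k. d k * x ^ k) \<longlongrightarrow> d 0) (at 0)"
  proof (rule powser_limit_0)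
    show "0 < r / 2" using r by simp
    fix x :: real assume x: "norm x < r / 2"
    have "summable (\<lambda>k. d k * (r / 2) ^ k)"
      using d[of "r / 2"] r by (simp add: sums_iff)
    then have "summable (\<lambda>k. d k * x ^ k)"
      by (rule powser_inside) (use x r in simp)
    then show "(\<lambda>k. d k * x ^ k) sums (\<Sum>k. d k * x ^ k)" by (rule summable_sums)
  qed
  then have lim: "((\<lambda>x. \<Sum>k. d k * x ^ k) \<longlongrightarrow> d 0) (at_right 0)"
    by (rule tendsto_mono[OF at_le[OF subset_UNIV]])
  have "eventually (\<lambda>x. (\<Sum>k. d k * x ^ k) = 0) (at_right 0)"
    unfolding eventually_at_right_field using d r by (auto simp: sums_iff intro!: exI[of _ r])
  then have "d 0 = 0"
    by (rule tendsto_unique[OF trivial_limit_at_right_real lim tendsto_eventually])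
  then show ?case by (simp add: d_def)
qed

lemma integral_powser:
  fixes q :: "'b \<Rightarrow> real"
  assumes M: "finite_measure M" and q: "q \<in> borel_measurable M"
    and B: "\<And>x. 0 \<le> q x" "\<And>x. q x \<le> B" "B < R"
    and F: "\<And>z. 0 \<le> z \<Longrightarrow> z < R \<Longrightarrow> (\<lambda>k. c k * z ^ k) sums F z"
  shows "(\<lambda>k. c k * (\<integral>x. q x ^ k \<partial>M)) sums (\<integral>x. F (q x) \<partial>M)"
proof -
  interpret finite_measure M by (rule M)
  note [measurable] = q
  have B0: "0 \<le> B" using B by (meson order_trans)
  obtain R' where R': "B < R'" "R' < R" using B(3) dense by blast
  have "summable (\<lambda>k. c k * R' ^ k)" using F[of R'] R' B0 by (simp add: sums_iff)
  then have sB: "summable (\<lambda>k. norm (c k * B ^ k))"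
    by (rule powser_insidea) (use R' B0 in simp)
  have le: "norm (c k * q x ^ k) \<le> norm (c k * B ^ k)" for k x
    using B(1,2)[of x] B0 by (simp add: abs_mult mult_left_mono power_mono)
  have int: "integrable M (\<lambda>x. c k * q x ^ k)" for k
    by (rule integrable_const_bound[of _ "norm (c k * B ^ k)"]) (auto simp only: le intro!: AE_I2, measurable)
  have sums: "(\<lambda>k. integral\<^sup>L M (\<lambda>x. c k * q x ^ k)) sums (\<integral>x. (\<Sum>k. c k * q x ^ k) \<partial>M)"
  proof (rule sums_integral[OF int])
    show "AE x in M. summable (\<lambda>k. norm (c k * q x ^ k))"
      by (intro AE_I2 summable_comparison_test'[OF sB]) (use le in simp)
    have "(\<integral>x. norm (c k * q x ^ k) \<partial>M) \<le> norm (c k * B ^ k) * measure M (space M)" for k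
      using integral_mono[OF integrable_norm[OF int[of k]], of "\<lambda>_. norm (c k * B ^ k)"] le
      by (simp add: mult.commute)
    then show "summable (\<lambda>k. \<integral>x. norm (c k * q x ^ k) \<partial>M)"
      by (intro summable_comparison_test'[OF summable_mult2[OF sB, of "measure M (space M)"]]) simp
  qed
  have "(\<Sum>k. c k * q x ^ k) = F (q x)" for x
    using F[of "q x"] B(1,2)[of x] B(3) by (simp add: sums_iff)
  with sums show ?thesis by simp
qed

text \<open>This is what makes every even moment recoverable from the binomial series of the square root.\<close>

lemma half_gchoose_nonzero: "((1 / 2 :: real) gchoose k) \<noteq> 0"
proof -
  have "(1 / 2 :: real) - of_nat i \<noteq> 0" for i
  proof
    assume "(1 / 2 :: real) - of_nat i = 0"
    then have "real (2 * i) = real 1" by simp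
    then have "2 * i = 1" by (simp only: of_nat_eq_iff)
    then show False by presburger
  qed
  then show ?thesis by (simp add: gbinomial_prod_rev)
qed

text \<open>The linear span of the functions \<open>cos (w \<bullet> u)\<close>.  It is closed under products by
\<open>cos a * cos b = (cos (a - b) + cos (a + b)) / 2\<close>, so the Stone--Weierstrass theorem applies without
polarising the powers \<open>(w \<bullet> u) ^ (2 * k)\<close>.\<close>

inductive_set cos_span :: "('a::euclidean_space projsp \<Rightarrow> real) set" where
  cos: "(\<lambda>x. cos (abs_inner_proj w x)) \<in> cos_span"
| add: "f \<in> cos_span \<Longrightarrow> g \<in> cos_span \<Longrightarrow> (\<lambda>x. f x + g x) \<in> cos_span"
| scale: "f \<in> cos_span \<Longrightarrow> (\<lambda>x. c * f x) \<in> cos_span"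

lemma continuous_on_cos_span: "f \<in> cos_span \<Longrightarrow> continuous_on UNIV f"
  by (induction rule: cos_span.induct) (auto intro!: continuous_intros continuous_on_abs_inner_proj)

lemma cos_span_const: "(\<lambda>x. c) \<in> cos_span"
  using cos_span.scale[OF cos_span.cos[of 0], of c] by (simp add: abs_inner_proj_rep)

lemma cos_span_mult:
  assumes "f \<in> cos_span" "g \<in> cos_span"
  shows "(\<lambda>x. f x * g x) \<in> cos_span"
  using assms(1)
proof induction
  case (cos w)
  show ?case using assms(2)
  proof induction
    case (cos v)
    have "cos (abs_inner_proj w x) * cos (abs_inner_proj v x) =
        1/2 * (cos (abs_inner_proj (w - v) x) + cos (abs_inner_proj (w + v) x))" for x
      by (simp add: abs_inner_proj_rep inner_diff_left inner_add_left cos_times_cos)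
    then show ?case
      by (simp only:) (intro cos_span.intros)
  next
    case (add f g)
    then show ?case using cos_span.add by (fastforce simp: distrib_left)
  next
    case (scale f c)
    then show ?case using cos_span.scale[of _ c] by (fastforce simp: mult.left_commute)
  qed
next
  case (add f g)
  then show ?case using cos_span.add by (fastforce simp: distrib_right)
next
  case (scale f c)
  then show ?case using cos_span.scale[of _ c] by (fastforce simp: mult.assoc)
qed

lemma cos_span_separates:
  assumes "x \<noteq> y"
  shows "\<exists>f\<in>cos_span. f x \<noteq> f y"
proof -
  let ?w = "rep_projsp x"
  have "abs_inner_proj ?w x = 1" "abs_inner_proj ?w y < 1"
    using abs_inner_proj_separates[OF assms] by auto
  then have "cos (abs_inner_proj ?w x) < cos (abs_inner_proj ?w y)"
    using abs_inner_proj_nonneg[of ?w y] pi_gt3 by (intro cos_monotone_0_pi) auto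
  then show ?thesis by (intro bexI[OF _ cos_span.cos[of ?w]]) simp
qed

lemma cos_span_dense:
  fixes f :: "'a::euclidean_space projsp \<Rightarrow> real"
  assumes "continuous_on UNIV f" "0 < e"
  shows "\<exists>g\<in>cos_span. \<forall>x. \<bar>f x - g x\<bar> < e"
proof -
  interpret function_ring_on "cos_span :: ('a projsp \<Rightarrow> real) set" UNIV
    by standard (auto intro: compact_projsp continuous_on_cos_span cos_span.add cos_span_mult
        cos_span_const cos_span_separates)
  show ?thesis using Stone_Weierstrass_basic[OF assms] by auto
qed

text \<open>Expanding in powers of \<open>\<tau>\<close>, the integrals of \<open>sqrt (1 + \<tau> (w \<bullet> u)\<^sup>2)\<close> determine all moments
\<open>\<integral>(w \<bullet> u) ^ (2 * k)\<close>, hence the integrals of \<open>cos (w \<bullet> u)\<close>, which span a dense algebra.\<close>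

lemma measure_eqI_sqrt_integrals:
  fixes \<mu> \<nu> :: "'a::euclidean_space projsp measure"
  assumes \<mu>: "finite_measure \<mu>" "sets \<mu> = sets borel"
    and \<nu>: "finite_measure \<nu>" "sets \<nu> = sets borel"
    and eq: "\<And>w \<tau>. 0 \<le> \<tau> \<Longrightarrow> (\<integral>x. sqrt (1 + \<tau> * (abs_inner_proj w x)\<^sup>2) \<partial>\<mu>) =
        (\<integral>x. sqrt (1 + \<tau> * (abs_inner_proj w x)\<^sup>2) \<partial>\<nu>)"
  shows "\<mu> = \<nu>"
proof -
  have meas: "(\<lambda>x. (abs_inner_proj w x)\<^sup>2) \<in> borel_measurable \<rho>" if "sets \<rho> = sets borel" for w :: 'a and \<rho>
  proof -
    have "abs_inner_proj w \<in> borel_measurable borel"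
      by (rule borel_measurable_continuous_onI[OF continuous_on_abs_inner_proj])
    then have [measurable]: "abs_inner_proj w \<in> borel_measurable \<rho>"
      using that by (simp cong: measurable_cong_sets)
    show ?thesis by measurable
  qed
  have sqle: "(abs_inner_proj w x)\<^sup>2 \<le> (norm w)\<^sup>2" for w :: 'a and x
    by (simp add: power_mono abs_inner_proj_le abs_inner_proj_nonneg)
  have moments: "(\<integral>x. ((abs_inner_proj w x)\<^sup>2) ^ k \<partial>\<mu>) = (\<integral>x. ((abs_inner_proj w x)\<^sup>2) ^ k \<partial>\<nu>)" for w k
  proof -
    define r where "r = inverse (1 + (norm w)\<^sup>2)"
    have series: "(\<lambda>k. (((1 / 2) gchoose k) * (\<integral>x. ((abs_inner_proj w x)\<^sup>2) ^ k \<partial>\<rho>)) * \<tau> ^ k) sums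
        (\<integral>x. sqrt (1 + \<tau> * (abs_inner_proj w x)\<^sup>2) \<partial>\<rho>)"
      if \<rho>: "finite_measure \<rho>" "sets \<rho> = sets borel" and \<tau>: "0 < \<tau>" "\<tau> < r" for \<rho> \<tau>
    proof -
      have "(\<lambda>k. ((1 / 2) gchoose k) * (\<integral>x. (\<tau> * (abs_inner_proj w x)\<^sup>2) ^ k \<partial>\<rho>)) sums
          (\<integral>x. sqrt (1 + \<tau> * (abs_inner_proj w x)\<^sup>2) \<partial>\<rho>)"
      proof (rule integral_powser[where F = "\<lambda>z. sqrt (1 + z)" and R = 1 and B = "\<tau> * (norm w)\<^sup>2"])
        show "(\<lambda>x. \<tau> * (abs_inner_proj w x)\<^sup>2) \<in> borel_measurable \<rho>"
          using meas[OF \<rho>(2)] by measurable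
        show "\<tau> * (abs_inner_proj w x)\<^sup>2 \<le> \<tau> * (norm w)\<^sup>2" for x
          using sqle[of w x] \<tau> by simp
        have "\<tau> * (1 + (norm w)\<^sup>2) < 1"
          using \<tau> by (simp add: r_def field_simps add_pos_nonneg)
        then show "\<tau> * (norm w)\<^sup>2 < 1"
          using \<tau> by (simp add: algebra_simps)
      qed (use \<rho> \<tau> sqrt_series in auto)
      then show ?thesis by (simp add: power_mult_distrib mult_ac)
    qed
    have "((1 / 2) gchoose k) * (\<integral>x. ((abs_inner_proj w x)\<^sup>2) ^ k \<partial>\<mu>) =
        ((1 / 2) gchoose k) * (\<integral>x. ((abs_inner_proj w x)\<^sup>2) ^ k \<partial>\<nu>)"
    proof (rule powser_coeff_unique[where r = r])
      show "0 < r" by (simp add: r_def add_pos_nonneg)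
    qed (use series[OF \<mu>] series[OF \<nu>] eq in auto)
    then show ?thesis using half_gchoose_nonzero[of k] by simp
  qed
  have coseq: "(\<integral>x. cos (abs_inner_proj w x) \<partial>\<mu>) = (\<integral>x. cos (abs_inner_proj w x) \<partial>\<nu>)" for w
  proof -
    have series: "(\<lambda>k. ((- 1) ^ k / fact (2 * k)) * (\<integral>x. ((abs_inner_proj w x)\<^sup>2) ^ k \<partial>\<rho>)) sums
        (\<integral>x. cos (abs_inner_proj w x) \<partial>\<rho>)"
      if \<rho>: "finite_measure \<rho>" "sets \<rho> = sets borel" for \<rho>
    proof -
      have "(\<lambda>k. ((- 1) ^ k / fact (2 * k)) * (\<integral>x. ((abs_inner_proj w x)\<^sup>2) ^ k \<partial>\<rho>)) sums
          (\<integral>x. cos (sqrt ((abs_inner_proj w x)\<^sup>2)) \<partial>\<rho>)"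
      proof (rule integral_powser[where F = "\<lambda>z. cos (sqrt z)" and R = "(norm w)\<^sup>2 + 1" and B = "(norm w)\<^sup>2"])
        fix z :: real assume "0 \<le> z"
        then show "(\<lambda>k. ((- 1) ^ k / fact (2 * k)) * z ^ k) sums cos (sqrt z)"
          using cos_paired[of "sqrt z"] by (simp add: power_mult)
      qed (use \<rho> meas sqle in auto)
      then show ?thesis by (simp add: abs_inner_proj_nonneg)
    qed
    show ?thesis
      using series[OF \<mu>] series[OF \<nu>] unfolding moments by (rule sums_unique2)
  qed
  have spaneq: "integral\<^sup>L \<mu> f = integral\<^sup>L \<nu> f" if "f \<in> cos_span" for f
    using that
  proof induction
    case (add f g)
    then show ?case
      using \<mu> \<nu> by (simp add: integrable_continuous_projsp continuous_on_cos_span)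
  qed (simp_all add: coseq)
  show ?thesis
  proof (rule projsp_measure_eqI[OF \<mu> \<nu>])
    fix f :: "'a projsp \<Rightarrow> real"
    assume f: "continuous_on UNIV f"
    define C where "C = measure \<mu> (space \<mu>) + measure \<nu> (space \<nu>)"
    have approx: "\<bar>integral\<^sup>L \<rho> f - integral\<^sup>L \<rho> g\<bar> \<le> e * measure \<rho> (space \<rho>)"
      if \<rho>: "finite_measure \<rho>" "sets \<rho> = sets borel" and g: "g \<in> cos_span" "\<And>x. \<bar>f x - g x\<bar> < e" for \<rho> g e
    proof -
      interpret finite_measure \<rho> by (rule \<rho>)
      have int: "integrable \<rho> f" "integrable \<rho> g"
        using f g \<rho> by (simp_all add: integrable_continuous_projsp continuous_on_cos_span)
      have "\<bar>integral\<^sup>L \<rho> f - integral\<^sup>L \<rho> g\<bar> = \<bar>\<integral>x. f x - g x \<partial>\<rho>\<bar>"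
        using int by simp
      also have "\<dots> \<le> (\<integral>x. \<bar>f x - g x\<bar> \<partial>\<rho>)" by (rule integral_abs_bound)
      also have "\<dots> \<le> (\<integral>x. e \<partial>\<rho>)"
        by (rule integral_mono) (use int g in \<open>auto intro: less_imp_le\<close>)
      finally show ?thesis by (simp add: mult.commute)
    qed
    have le: "\<bar>integral\<^sup>L \<mu> f - integral\<^sup>L \<nu> f\<bar> \<le> e * C" if "0 < e" for e
    proof -
      obtain g where g: "g \<in> cos_span" "\<And>x. \<bar>f x - g x\<bar> < e"
        using cos_span_dense[OF f \<open>0 < e\<close>] by blast
      then show ?thesis
        using approx[OF \<mu> g] approx[OF \<nu> g] spaneq[OF g(1)] unfolding C_def distrib_left by linarith
    qed
    have "((\<lambda>e. e * C) \<longlongrightarrow> 0 * C) (at_right 0)"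
      by (intro tendsto_intros)
    moreover have "eventually (\<lambda>e. \<bar>integral\<^sup>L \<mu> f - integral\<^sup>L \<nu> f\<bar> \<le> e * C) (at_right 0)"
      using le by (auto simp: eventually_at_right_field intro!: exI[of _ 1])
    ultimately have "\<bar>integral\<^sup>L \<mu> f - integral\<^sup>L \<nu> f\<bar> \<le> 0 * C"
      by (rule tendsto_lowerbound) simp
    then show "integral\<^sup>L \<mu> f = integral\<^sup>L \<nu> f" by simp
  qed
qed

text \<open>
  Passing from the square roots of quadratic forms in \<open>g t\<close> to functions on projective space uses that
  \<open>sqrt ((norm v)\<^sup>2 + \<tau> (w \<bullet> v)\<^sup>2)\<close> is the degree 1 homogeneous extension of
  \<open>sqrt (1 + \<tau> (w \<bullet> u)\<^sup>2)\<close>.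
\<close>

theorem cosine_transform_injective:
  fixes g h :: "'t \<Rightarrow> 'a::euclidean_space"
  assumes M: "sigma_finite_measure M" and g: "integrable M g" and h: "integrable M h"
    and eq: "\<And>\<xi>. (\<integral>t. \<bar>\<xi> \<bullet> g t\<bar> \<partial>M) = (\<integral>t. \<bar>\<xi> \<bullet> h t\<bar> \<partial>M)"
  shows "direction_measure M g = direction_measure M h"
proof (rule measure_eqI_sqrt_integrals)
  fix w :: 'a and \<tau> :: real
  assume \<tau>: "0 \<le> \<tau>"
  define f :: "'a projsp \<Rightarrow> real" where "f x = sqrt (1 + \<tau> * (abs_inner_proj w x)\<^sup>2)" for x
  have f: "continuous_on UNIV f"
    unfolding f_def by (intro continuous_intros continuous_on_abs_inner_proj)
  have "hom_ext f v = sqrt ((norm v)\<^sup>2 + \<tau> * (w \<bullet> v)\<^sup>2)" for v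
  proof (cases "v = 0")
    case False
    have "hom_ext f v = sqrt ((norm v)\<^sup>2 * (1 + \<tau> * (w \<bullet> sgn v)\<^sup>2))"
      using False by (simp add: hom_ext_def f_def abs_inner_proj_proj norm_sgn real_sqrt_mult)
    also have "(norm v)\<^sup>2 * (1 + \<tau> * (w \<bullet> sgn v)\<^sup>2) = (norm v)\<^sup>2 + \<tau> * (w \<bullet> (norm v *\<^sub>R sgn v))\<^sup>2"
      by (simp add: algebra_simps power_mult_distrib)
    also have "norm v *\<^sub>R sgn v = v"
      using False by (simp add: sgn_div_norm)
    finally show ?thesis .
  qed (simp add: hom_ext_def)
  then show "(\<integral>x. sqrt (1 + \<tau> * (abs_inner_proj w x)\<^sup>2) \<partial>direction_measure M g) =
      (\<integral>x. sqrt (1 + \<tau> * (abs_inner_proj w x)\<^sup>2) \<partial>direction_measure M h)"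
    using integral_direction_measure[OF g f] integral_direction_measure[OF h f]
      rank_one_perturbation[OF M g h eq \<tau>, of w]
    by (simp flip: f_def)
qed (simp_all add: finite_direction_measure g h sets_direction_measure)

section \<open>The measure of a curve\<close>

lemma set_integral_lebesgue_on:
  fixes f :: "real \<Rightarrow> real"
  shows "(LINT t:{0..1}|lebesgue. f t) = (\<integral>t. f t \<partial>lebesgue_on {0..1})"
  by (simp add: set_lebesgue_integral_def integral_restrict_space)

lemma curve_measure_eq_direction_measure:
  assumes "abs_cont_curve \<alpha>"
  shows "curve_measure \<alpha> = direction_measure (lebesgue_on {0..1}) (curve_deriv \<alpha>)"
  unfolding curve_measure_def set_integral_lebesgue_on
  by (rule direction_measure_unique[OF curve_deriv_integrable[OF assms]])

lemma proj_length_eq_integral: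
  assumes "abs_cont_curve \<alpha>"
  shows "proj_length \<alpha> \<xi> = integral\<^sup>L (curve_measure \<alpha>) (abs_inner_proj \<xi>)"
  using integral_direction_measure[OF curve_deriv_integrable[OF assms] continuous_on_abs_inner_proj]
  by (simp add: curve_measure_eq_direction_measure[OF assms] proj_length_def set_integral_lebesgue_on
      hom_ext_abs_inner_proj)

lemma proj_length_scaleR: "proj_length \<alpha> (r *\<^sub>R \<xi>) = \<bar>r\<bar> * proj_length \<alpha> \<xi>"
  by (simp add: proj_length_def set_integral_lebesgue_on abs_mult)

lemma curve_measure_determined:
  assumes \<alpha>: "abs_cont_curve \<alpha>" and \<beta>: "abs_cont_curve \<beta>"
    and eq: "\<And>\<xi>. \<xi> \<in> sphere 0 1 \<Longrightarrow> proj_length \<alpha> \<xi> = proj_length \<beta> \<xi>"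
  shows "curve_measure \<alpha> = curve_measure \<beta>"
proof -
  have "proj_length \<alpha> \<xi> = proj_length \<beta> \<xi>" for \<xi>
  proof (cases "\<xi> = 0")
    case True
    then show ?thesis by (simp add: proj_length_def)
  next
    case False
    then have "\<xi> = norm \<xi> *\<^sub>R sgn \<xi>" and "sgn \<xi> \<in> sphere 0 1"
      by (simp_all add: sgn_div_norm norm_sgn)
    then show ?thesis using eq[of "sgn \<xi>"] proj_length_scaleR[of _ "norm \<xi>" "sgn \<xi>"] by metis
  qed
  moreover have "sigma_finite_measure (lebesgue_on {0..1 :: real})"
    by (intro finite_measure.axioms(1) finite_measure_lebesgue_on) simp
  ultimately have "direction_measure (lebesgue_on {0..1}) (curve_deriv \<alpha>) =
      direction_measure (lebesgue_on {0..1}) (curve_deriv \<beta>)"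
    by (intro cosine_transform_injective curve_deriv_integrable \<alpha> \<beta>)
      (simp_all add: proj_length_def set_integral_lebesgue_on)
  then show ?thesis by (simp add: curve_measure_eq_direction_measure \<alpha> \<beta>)
qed

theorem mainTheorem1:
  shows "(\<forall>(\<alpha> :: real \<Rightarrow> real ^ 'n). abs_cont_curve \<alpha> \<longrightarrow>
           (\<forall>\<xi>\<in>sphere 0 1. proj_length \<alpha> \<xi> = integral\<^sup>L (curve_measure \<alpha>) (abs_inner_proj \<xi>))) \<and>
         (\<forall>(\<alpha> :: real \<Rightarrow> real ^ 'n) \<beta>. abs_cont_curve \<alpha> \<longrightarrow> abs_cont_curve \<beta> \<longrightarrow>
           (\<forall>\<xi>\<in>sphere 0 1. proj_length \<alpha> \<xi> = proj_length \<beta> \<xi>) \<longrightarrow>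
           curve_measure \<alpha> = curve_measure \<beta>)"
  using proj_length_eq_integral curve_measure_determined by blast

end
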